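(* There exists an atomic Puiseux monoid $M$ with full system of sets of lengths; that is, there exists an atomic Puiseux monoid $M$ which is a BF-monoid and satisfies $$\mathcal{L}(M) = \big\{\{0\}, \{1\}\big\} \cup \big\{ S \mid S \subseteq \mathbb{Z}_{\ge 2},\ S \neq \emptyset,\ |S| < \infty \big\}.$$
   Context: A Puiseux monoid is an additive submonoid of $\mathbb{Q}_{\ge 0}$ (containing $0$). An atom of a Puiseux monoid $M$ is a nonzero element $a \in M$ such that $a = u+v$ with $u,v \in M$ implies $u = 0$ or $v = 0$; $\mathcal{A}(M)$ is the set of atoms, and $M$ is atomic if $\mathcal{A}(M)$ generates $M$. A factorization of $x \in M$ is a formal (unordered) sum $a_1 + \dots + a_n$ of atoms, i.e. an element of the free commutative monoid on $\mathcal{A}(M)$, whose value in $M$ is $x$; its length is $n$ (the empty sum, of length $0$, is the only factorization of $0$). The set of lengths $\mathsf{L}(x)$ is the set of all lengths of factorizations of $x$, and $\mathcal{L}(M) = \{\mathsf{L}(x) \mid x \in M\}$ is the system of sets of lengths of $M$. An atomic monoid $M$ is a BF-monoid if $\mathsf{L}(x)$ is finite for all $x \in M$. *)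

theory Defs
  imports Complex_Main "HOL-Library.Multiset"
begin

definition puiseux_monoid :: "rat set \<Rightarrow> bool" where
  "puiseux_monoid M \<longleftrightarrow>
     0 \<in> M \<and> (\<forall>x\<in>M. 0 \<le> x) \<and> (\<forall>x\<in>M. \<forall>y\<in>M. x + y \<in> M)"

definition atoms :: "rat set \<Rightarrow> rat set" where
  "atoms M = {a \<in> M. a \<noteq> 0 \<and> (\<forall>u\<in>M. \<forall>v\<in>M. a = u + v \<longrightarrow> u = 0 \<or> v = 0)}"

(* The hull is the least Puiseux monoid containing the atoms of M. If M is a Puiseux monoid,
   this is the submonoid of M generated by the atoms. *)
definition atomic :: "rat set \<Rightarrow> bool" where
  "atomic M \<longleftrightarrow> puiseux_monoid hull (atoms M) = M"

(* Finite multisets over the atoms are the elements of the free commutative monoid on them. *)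
definition factorizations :: "rat set \<Rightarrow> rat \<Rightarrow> rat multiset set" where
  "factorizations M x = {F. set_mset F \<subseteq> atoms M \<and> sum_mset F = x}"

definition set_of_lengths :: "rat set \<Rightarrow> rat \<Rightarrow> nat set" where
  "set_of_lengths M x = size ` factorizations M x"

definition system_of_sets_of_lengths :: "rat set \<Rightarrow> nat set set" where
  "system_of_sets_of_lengths M = set_of_lengths M ` M"

definition BF_monoid :: "rat set \<Rightarrow> bool" where
  "BF_monoid M \<longleftrightarrow> atomic M \<and> (\<forall>x\<in>M. finite (set_of_lengths M x))"

end

theory Submission
  imports Defs "HOL-Library.Nat_Bijection" "HOL-Library.Infinite_Set"
    "HOL-Computational_Algebra.Primes"
begin

text \<open>
  Enumerate the finite sets as S_j and attach to S_j the element x_j = 2^e / r_j, with distinct odd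
  primes r_j.  For each length l in S_j with l at least 2 take a further large odd prime p, write it
  as (l - 1) q + (q + r) with q = p div l and r = p mod l, and let the monoid be generated by all the
  rationals x_j q / p and x_j (q + r) / p.  By construction x_j is a sum of l generators.
  Conversely, in a factorization of x_j, integrality at r_j forces some generator with index (j, l)
  to occur; integrality at p then forces the generators with this index to sum to a positive
  multiple of x_j, hence to x_j itself, and since q and q + r are both close to p / l there are
  exactly l of them.  Choosing e large makes all generators at least 1, which bounds the lengths.
\<close>

section \<open>Monoids generated by rationals bounded away from zero\<close>

text \<open>Phrased with multisets, as \<open>factorizations\<close> is, so that once the generators
  are known to be the atoms, a representation of an element is already a factorization.\<close>

definition generated_monoid :: "rat set \<Rightarrow> rat set" where
  "generated_monoid G = {sum_mset F | F. set_mset F \<subseteq> G}"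

lemma sum_mset_ge_size:
  fixes f :: "'a \<Rightarrow> 'b :: linordered_semidom"
  assumes "\<And>x. x \<in># F \<Longrightarrow> c \<le> f x"
  shows "of_nat (size F) * c \<le> (\<Sum>x\<in>#F. f x)"
  using assms by (induction F) (auto simp: distrib_right intro!: add_mono)

lemma sum_mset_le_size:
  fixes f :: "'a \<Rightarrow> 'b :: linordered_semidom"
  assumes "\<And>x. x \<in># F \<Longrightarrow> f x \<le> c"
  shows "(\<Sum>x\<in>#F. f x) \<le> of_nat (size F) * c"
  using assms by (induction F) (auto simp: distrib_right intro!: add_mono)

text \<open>Choosing a preimage of each element by \<open>inv_into\<close> lifts a multiset of
  generators to a multiset of indices, where the index of every summand is visible.\<close>

lemma mset_subset_imageE:
  assumes "set_mset F \<subseteq> f ` I"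
  obtains F' where "set_mset F' \<subseteq> I" and "F = image_mset f F'"
proof
  show "set_mset (image_mset (inv_into I f) F) \<subseteq> I"
    using assms by (auto intro: inv_into_into)
  have "image_mset f (image_mset (inv_into I f) F) = image_mset id F"
    unfolding multiset.map_comp
    by (rule image_mset_cong) (use assms in \<open>auto simp: f_inv_into_f\<close>)
  then show "F = image_mset f (image_mset (inv_into I f) F)" by simp
qed

lemma generated_monoid_empty: "0 \<in> generated_monoid G"
  unfolding generated_monoid_def by (auto intro: exI[of _ "{#}"])

lemma generated_monoid_add:
  assumes "x \<in> generated_monoid G" "y \<in> generated_monoid G"
  shows "x + y \<in> generated_monoid G"
proof -
  from assms obtain A B where "x = sum_mset A" "y = sum_mset B" "set_mset (A + B) \<subseteq> G"
    by (auto simp: generated_monoid_def)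
  then show ?thesis
    unfolding generated_monoid_def by (auto intro!: exI[of _ "A + B"])
qed

lemma generated_monoid_superset: "G \<subseteq> generated_monoid G"
  unfolding generated_monoid_def by (auto intro!: exI[of _ "{#_#}"])

lemma puiseux_monoid_sum_mset:
  assumes "puiseux_monoid M" "set_mset F \<subseteq> M"
  shows "sum_mset F \<in> M"
  using assms(2) by (induction F) (use assms(1) in \<open>auto simp: puiseux_monoid_def\<close>)

text \<open>\<open>ge_1\<close> bounds the length of a factorization by its value, which gives the
  BF property; \<open>minimal\<close> makes every generator an atom.\<close>

locale minimal_generators =
  fixes G :: "rat set"
  assumes ge_1: "g \<in> G \<Longrightarrow> 1 \<le> g"
    and minimal: "set_mset F \<subseteq> G \<Longrightarrow> sum_mset F \<in> G \<Longrightarrow> size F = 1"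
begin

lemma size_le_sum_mset: "set_mset F \<subseteq> G \<Longrightarrow> of_nat (size F) \<le> sum_mset F"
  using sum_mset_ge_size[of F 1 "\<lambda>x. x"] ge_1 by auto

lemma puiseux_monoid_generated: "puiseux_monoid (generated_monoid G)"
proof -
  have "0 \<le> x" if "x \<in> generated_monoid G" for x
  proof -
    from that obtain F where F: "set_mset F \<subseteq> G" "x = sum_mset F"
      by (auto simp: generated_monoid_def)
    have "0 \<le> rat_of_nat (size F)" by simp
    also have "\<dots> \<le> x" using size_le_sum_mset F by simp
    finally show ?thesis .
  qed
  then show ?thesis
    by (simp add: puiseux_monoid_def generated_monoid_empty generated_monoid_add)
qed

text \<open>Splitting one generator off a nonempty sum that represents an atom leaves 0, so the atom
  is that generator. Conversely, two nonempty sums together have at least two summands, so by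
  \<open>minimal\<close> they cannot add up to a generator.\<close>

lemma atoms_generated: "atoms (generated_monoid G) = G"
proof (intro equalityI subsetI)
  fix a assume a: "a \<in> atoms (generated_monoid G)"
  then obtain F where F: "set_mset F \<subseteq> G" "a = sum_mset F"
    by (auto simp: atoms_def generated_monoid_def)
  with a have "F \<noteq> {#}" by (auto simp: atoms_def)
  then obtain g F' where F': "F = add_mset g F'" by (meson multiset_cases)
  have "g \<noteq> 0" using ge_1[of g] F F' by auto
  moreover have "g \<in> generated_monoid G" "sum_mset F' \<in> generated_monoid G"
    using F F' generated_monoid_superset by (auto simp: generated_monoid_def)
  ultimately have "sum_mset F' = 0" using a F F' by (auto simp: atoms_def)
  then show "a \<in> G" using F F' by auto
next
  fix g assume g: "g \<in> G"
  have "u = 0 \<or> v = 0"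
    if uv: "u \<in> generated_monoid G" "v \<in> generated_monoid G" "g = u + v" for u v
  proof -
    from uv obtain A B where AB: "u = sum_mset A" "v = sum_mset B" "set_mset (A + B) \<subseteq> G"
      by (auto simp: generated_monoid_def)
    then have "size (A + B) = 1" using minimal[of "A + B"] uv g by auto
    then have "A = {#} \<or> B = {#}" by (auto simp: add_is_1)
    then show ?thesis using AB by auto
  qed
  then show "g \<in> atoms (generated_monoid G)"
    using g ge_1[OF g] generated_monoid_superset by (auto simp: atoms_def)
qed

lemma atomic_generated: "atomic (generated_monoid G)"
  unfolding atomic_def atoms_generated
proof (rule hull_unique)
  show "G \<subseteq> generated_monoid G" by (rule generated_monoid_superset)
  show "puiseux_monoid (generated_monoid G)" by (rule puiseux_monoid_generated)
  show "generated_monoid G \<subseteq> M" if "G \<subseteq> M" "puiseux_monoid M" for M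
  proof
    fix x assume "x \<in> generated_monoid G"
    then obtain F where F: "set_mset F \<subseteq> G" "x = sum_mset F"
      by (auto simp: generated_monoid_def)
    have "set_mset F \<subseteq> M" using F that by blast
    then show "x \<in> M" using puiseux_monoid_sum_mset that F by simp
  qed
qed

lemma set_of_lengths_generated:
  "set_of_lengths (generated_monoid G) x = {size F | F. set_mset F \<subseteq> G \<and> sum_mset F = x}"
  by (auto simp: set_of_lengths_def factorizations_def atoms_generated)

lemma finite_set_of_lengths: "finite (set_of_lengths (generated_monoid G) x)"
proof (rule finite_subset)
  show "set_of_lengths (generated_monoid G) x \<subseteq> {.. nat \<lfloor>x\<rfloor>}"
  proof
    fix n assume "n \<in> set_of_lengths (generated_monoid G) x"
    then have "of_nat n \<le> x" using size_le_sum_mset by (auto simp: set_of_lengths_generated)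
    then show "n \<in> {.. nat \<lfloor>x\<rfloor>}" by (simp add: le_nat_iff le_floor_iff)
  qed
qed simp

lemma BF_monoid_generated: "BF_monoid (generated_monoid G)"
  using atomic_generated finite_set_of_lengths by (simp add: BF_monoid_def)

lemma set_of_lengths_zero: "set_of_lengths (generated_monoid G) 0 = {0}"
proof -
  have "size F = 0" if "set_mset F \<subseteq> G" "sum_mset F = 0" for F
    using size_le_sum_mset[OF that(1)] that(2) by simp
  then show ?thesis
    by (auto simp: set_of_lengths_generated intro!: exI[of _ "{#}"])
qed

lemma set_of_lengths_generator:
  assumes "g \<in> G" shows "set_of_lengths (generated_monoid G) g = {1}"
  using minimal assms by (auto simp: set_of_lengths_generated intro!: exI[of _ "{#g#}"])

text \<open>Length 0 forces \<open>x = 0\<close>, and length 1 forces \<open>x\<close> to be a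
  generator, whose only length is 1. In all other cases every length is at least 2.\<close>

lemma set_of_lengths_cases:
  assumes "x \<in> generated_monoid G"
  shows "set_of_lengths (generated_monoid G) x
    \<in> {{0}, {1}} \<union> {S. S \<subseteq> {2..} \<and> S \<noteq> {} \<and> finite S}" (is "?L x \<in> _")
proof -
  consider "0 \<in> ?L x" | "1 \<in> ?L x" | "0 \<notin> ?L x" "1 \<notin> ?L x" by blast
  then show ?thesis
  proof cases
    case 1
    then have "x = 0" by (auto simp: set_of_lengths_generated)
    then show ?thesis using set_of_lengths_zero by simp
  next
    case 2
    then obtain F where F: "set_mset F \<subseteq> G" "sum_mset F = x" "size F = 1"
      by (auto simp: set_of_lengths_generated)
    from F(3) obtain a where "F = {#a#}" using size_1_singleton_mset by blast
    with F have "x \<in> G" by simp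
    then show ?thesis using set_of_lengths_generator by simp
  next
    case 3
    have "n \<in> {2..}" if "n \<in> ?L x" for n
      using 3 that by (cases n rule: nat.exhaust) (auto simp: Suc_le_eq numeral_2_eq_2 intro!: gr0I)
    moreover have "?L x \<noteq> {}"
      using assms unfolding set_of_lengths_generated by (auto simp: generated_monoid_def)
    ultimately show ?thesis using finite_set_of_lengths by auto
  qed
qed

end

section \<open>Integrality at a prime\<close>

text \<open>For prime \<open>p\<close> this is membership in the localization of the integers at
  \<open>p\<close>. The fraction need not be reduced, and \<open>b\<close> is automatically nonzero
  because \<open>p\<close> divides 0.\<close>

definition integral_at :: "nat \<Rightarrow> rat \<Rightarrow> bool" where
  "integral_at p y \<longleftrightarrow> (\<exists>a b. \<not> int p dvd b \<and> y = of_int a / of_int b)"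

lemma integral_at_divide:
  assumes "\<not> p dvd b" shows "integral_at p (of_nat a / of_nat b)"
  unfolding integral_at_def using assms by (intro exI[of _ "int a"] exI[of _ "int b"]) simp

lemma integral_at_0:
  assumes "prime p" shows "integral_at p 0"
  using integral_at_divide[of p 1 0] prime_gt_1_nat[OF assms] by simp

lemma integral_at_add:
  assumes p: "prime p" and "integral_at p x" "integral_at p y"
  shows "integral_at p (x + y)"
proof -
  from assms obtain a b c d where *: "\<not> int p dvd b" "x = of_int a / of_int b"
    "\<not> int p dvd d" "y = of_int c / of_int d" unfolding integral_at_def by blast
  then have "b \<noteq> 0" "d \<noteq> 0" by auto
  with * have "x + y = of_int (a * d + c * b) / of_int (b * d)"
    by (simp add: field_simps)
  moreover have "\<not> int p dvd b * d" using * p by (simp add: prime_dvd_mult_iff)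
  ultimately show ?thesis unfolding integral_at_def by blast
qed

lemma integral_at_uminus: "integral_at p x \<Longrightarrow> integral_at p (- x)"
  unfolding integral_at_def by (metis minus_divide_left of_int_minus)

lemma integral_at_diff:
  assumes "prime p" "integral_at p x" "integral_at p y"
  shows "integral_at p (x - y)"
  using integral_at_add[OF assms(1,2) integral_at_uminus[OF assms(3)]] by simp

lemma integral_at_sum_mset:
  assumes "prime p" "\<And>i. i \<in># F \<Longrightarrow> integral_at p (f i)"
  shows "integral_at p (\<Sum>i\<in>#F. f i)"
  using assms(2) by (induction F) (auto intro: integral_at_0 integral_at_add assms(1))

text \<open>Cross-multiplication shows that \<open>p\<close> divides \<open>n * b\<close>, where
  \<open>b\<close> is prime to \<open>p\<close>. The factor \<open>m\<close> absorbs whatever else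
  stands in the denominator.\<close>

lemma integral_at_divide_dvd:
  assumes p: "prime p" and "integral_at p (of_nat n / of_nat (m * p))" and "m > 0"
  shows "p dvd n"
proof -
  from assms(2) obtain a b where *: "\<not> int p dvd b" "of_nat n / of_nat (m * p) = (of_int a / of_int b :: rat)"
    unfolding integral_at_def by blast
  then have "b \<noteq> 0" by auto
  then have "(of_nat n * of_int b :: rat) = of_int a * of_nat (m * p)"
    using * p \<open>m > 0\<close> by (simp add: divide_simps prime_gt_0_nat)
  then have "(of_int (int n * b) :: rat) = of_int (a * int (m * p))" by simp
  then have "int n * b = a * int (m * p)" by (simp only: of_int_eq_iff)
  then have "int p dvd int n * b" by simp
  then show ?thesis using * p by (simp add: prime_dvd_mult_iff)
qed

section \<open>The generators\<close>

text \<open>The cube keeps the quotient by l above the square of l; the values at l = 0 serve as the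
  denominators r_j.\<close>

definition idx_prime :: "nat \<Rightarrow> nat \<Rightarrow> nat" where
  "idx_prime j l = enumerate {p. prime p} ((prod_encode (j, l) + 3) ^ 3)"

lemma infinite_primes: "infinite {p :: nat. prime p}"
  by (rule primes_infinite)

lemma prime_idx_prime: "prime (idx_prime j l)"
  using enumerate_in_set[OF infinite_primes] by (simp add: idx_prime_def)

lemma idx_prime_eq_iff: "idx_prime j l = idx_prime j' l' \<longleftrightarrow> j = j' \<and> l = l'"
proof
  assume "idx_prime j l = idx_prime j' l'"
  then have "(prod_encode (j, l) + 3) ^ 3 = (prod_encode (j', l') + 3) ^ 3"
    unfolding idx_prime_def
    using strict_mono_enumerate[OF infinite_primes] by (simp only: strict_mono_eq)
  then have "prod_encode (j, l) = prod_encode (j', l')"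
    by (simp add: power_eq_iff_eq_base)
  then show "j = j' \<and> l = l'" by (simp add: prod_encode_eq)
qed simp

text \<open>The prime with index n is at least n, and a pair code dominates its second
  component.\<close>

lemma idx_prime_ge: "(l + 3) ^ 3 \<le> idx_prime j l"
proof -
  have "(l + 3) ^ 3 \<le> (prod_encode (j, l) + 3) ^ 3"
    by (intro power_mono add_right_mono le_prod_encode_2) simp
  also have "\<dots> \<le> idx_prime j l"
    unfolding idx_prime_def by (rule le_enumerate[OF infinite_primes])
  finally show ?thesis .
qed

lemma idx_prime_gt_2: "2 < idx_prime j l"
proof -
  have "2 < (3::nat) ^ 3" by simp
  also have "\<dots> \<le> (l + 3) ^ 3" by (rule power_mono) auto
  finally show ?thesis using idx_prime_ge by (rule less_le_trans)
qed

lemma prime_not_dvd_idx_prime: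
  assumes "prime p" "p \<noteq> idx_prime j l" shows "\<not> p dvd idx_prime j l"
  using assms prime_idx_prime primes_dvd_imp_eq by blast

lemma idx_prime_not_dvd_2_power: "\<not> idx_prime j l dvd 2 ^ k"
  using idx_prime_gt_2[of j l] prime_idx_prime[of j l]
  by (metis dvd_imp_le linorder_not_less pos2 prime_dvd_power)

text \<open>A power of 2 is prime to every denominator in play.\<close>

definition numer :: "nat \<Rightarrow> nat" where
  "numer j = 2 ^ (idx_prime j 0 * (j + 1))"

definition target :: "nat \<Rightarrow> rat" where
  "target j = of_nat (numer j) / of_nat (idx_prime j 0)"

text \<open>The flag marks the summand that absorbs the remainder: one flagged part and
  \<open>l - 1\<close> unflagged ones add up to the prime.\<close>

definition part :: "nat \<times> nat \<times> bool \<Rightarrow> nat" where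
  "part = (\<lambda>(j, l, b). idx_prime j l div l + (if b then idx_prime j l mod l else 0))"

definition gen :: "nat \<times> nat \<times> bool \<Rightarrow> rat" where
  "gen = (\<lambda>(j, l, b). target j * of_nat (part (j, l, b)) / of_nat (idx_prime j l))"

text \<open>The finite sets are enumerated by \<^const>\<open>set_decode\<close>.\<close>

definition Idx :: "(nat \<times> nat \<times> bool) set" where
  "Idx = {(j, l, b). l \<in> set_decode j \<and> 2 \<le> l}"

text \<open>The exponent in \<open>numer\<close> is chosen for this bound: 2^n > n at n =
  \<open>idx_prime j 0 * (j + 1)\<close>, divided by \<open>idx_prime j 0\<close>.\<close>

lemma target_gt: "of_nat j + 1 < target j"
proof -
  have "idx_prime j 0 * (j + 1) < numer j" unfolding numer_def by (rule less_exp)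
  then have "of_nat (idx_prime j 0 * (j + 1)) < (of_nat (numer j) :: rat)"
    by (simp only: of_nat_less_iff)
  then show ?thesis
    using idx_prime_gt_2[of j 0] unfolding target_def
    by (simp add: field_simps)
qed

lemma target_pos: "0 < target j"
  using target_gt[of j] by (rule le_less_trans[rotated]) simp

section \<open>Size estimates for the parts and the generators\<close>

lemma idx_prime_bounds:
  fixes j l :: nat
  assumes "2 \<le> l"
  defines "q \<equiv> idx_prime j l div l" and "r \<equiv> idx_prime j l mod l"
  shows "idx_prime j l = l * q + r" "l * l \<le> q" "r < l" "r < q"
proof -
  show 1: "idx_prime j l = l * q + r" by (simp add: q_def r_def)
  have "l * l * l \<le> (l + 3) ^ 3"
    by (simp add: power3_eq_cube mult_le_mono)
  then have "l * l * l \<le> idx_prime j l" using idx_prime_ge le_trans by blast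
  then show 2: "l * l \<le> q" unfolding q_def using assms(1) by (simp add: less_eq_div_iff_mult_less_eq)
  show "r < l" using assms(1) by (simp add: r_def)
  also have "l \<le> l * l" by simp
  finally show "r < q" using 2 by simp
qed

text \<open>With quotient q and remainder r < q, the strict upper bounds are q + r < 2q <= lq, which
  puts every part below the prime, and lq + r < (l + 1)q, which puts the prime below l + 1
  parts.\<close>

lemma part_bounds:
  assumes "2 \<le> l"
  shows "idx_prime j l div l \<le> part (j, l, b)"
    "part (j, l, b) \<le> idx_prime j l div l + idx_prime j l mod l"
    "0 < part (j, l, b)" "part (j, l, b) < idx_prime j l" "idx_prime j l < (l + 1) * part (j, l, b)"
proof -
  let ?q = "idx_prime j l div l" and ?r = "idx_prime j l mod l"
  note b = idx_prime_bounds[OF assms, of j]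
  show 1: "?q \<le> part (j, l, b)" "part (j, l, b) \<le> ?q + ?r" by (auto simp: part_def)
  show "0 < part (j, l, b)" using b 1 by linarith
  have "?q * 2 \<le> l * ?q" using assms by simp
  then show "part (j, l, b) < idx_prime j l" using b 1 by linarith
  have "idx_prime j l < (l + 1) * ?q" using b(1,4) by (simp only: distrib_right)
  also have "\<dots> \<le> (l + 1) * part (j, l, b)" using 1 by (intro mult_le_mono2)
  finally show "idx_prime j l < (l + 1) * part (j, l, b)" .
qed

text \<open>A part exceeds the fraction 1/(l + 1) of its prime, and \<open>target j\<close> exceeds
  j + 1, which is at least l + 1.\<close>

lemma gen_ge_1:
  assumes "i \<in> Idx" shows "1 \<le> gen i"
proof -
  obtain j l b where i: "i = (j, l, b)" "l \<in> set_decode j" "2 \<le> l"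
    using assms by (auto simp: Idx_def)
  \<comment> \<open>The elements of \<open>set_decode j\<close> are the positions of the binary
    digits 1 of j, so 2^l <= j.\<close>
  have "l \<le> j"
  proof -
    have "l < 2 ^ l" by (rule less_exp)
    also have "2 ^ l \<le> j"
      using i(2) by (metis bot_nat_0.extremum_uniqueI div_less linorder_not_less odd_pos set_decode_def mem_Collect_eq even_zero)
    finally show ?thesis by simp
  qed
  have "of_nat (idx_prime j l) < (of_nat ((l + 1) * part (j, l, b)) :: rat)"
    using part_bounds(5)[OF i(3)] by (simp only: of_nat_less_iff)
  also have "\<dots> = of_nat (l + 1) * of_nat (part (j, l, b))" by (rule of_nat_mult)
  also have "\<dots> \<le> target j * of_nat (part (j, l, b))"
  proof (rule mult_right_mono)
    have "of_nat (l + 1) \<le> (of_nat (j + 1) :: rat)" using \<open>l \<le> j\<close> by (simp only: of_nat_le_iff)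
    then show "of_nat (l + 1) \<le> target j" using target_gt[of j] by simp
  qed simp
  finally show ?thesis
    using idx_prime_gt_2[of j l] by (simp add: gen_def i(1) le_divide_eq)
qed

section \<open>Denominators of generators and targets\<close>

lemma gen_integral_at:
  assumes "prime p" "p \<noteq> idx_prime j 0" "p \<noteq> idx_prime j l"
  shows "integral_at p (gen (j, l, b))"
proof -
  have "\<not> p dvd idx_prime j 0 * idx_prime j l"
    using assms prime_not_dvd_idx_prime by (simp add: prime_dvd_mult_iff)
  from integral_at_divide[OF this, of "numer j * part (j, l, b)"]
  show ?thesis by (simp add: gen_def target_def)
qed

lemma target_integral_at:
  assumes "prime p" "p \<noteq> idx_prime j 0"
  shows "integral_at p (target j)"
  unfolding target_def using integral_at_divide[OF prime_not_dvd_idx_prime] assms by simp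

lemma target_not_integral: "\<not> integral_at (idx_prime j 0) (target j)"
  using integral_at_divide_dvd[OF prime_idx_prime, of j 0 "numer j" 1] idx_prime_not_dvd_2_power
  by (auto simp: target_def numer_def)

text \<open>The numerator of \<open>target j\<close> is a power of 2 and cannot cancel the odd
  prime, so \<open>c\<close> has to.\<close>

lemma multiple_target_dvd:
  assumes "integral_at (idx_prime j l) (target j * of_nat c / of_nat (idx_prime j l))"
  shows "idx_prime j l dvd c"
proof -
  have "integral_at (idx_prime j l) (of_nat (numer j * c) / of_nat (idx_prime j 0 * idx_prime j l))"
    using assms by (simp add: target_def)
  then have "idx_prime j l dvd numer j * c"
    using idx_prime_gt_2[of j 0] by (intro integral_at_divide_dvd[OF prime_idx_prime]) auto
  then show ?thesis
    using prime_idx_prime idx_prime_not_dvd_2_power by (auto simp: prime_dvd_mult_iff numer_def)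
qed

text \<open>\<open>A\<close> collects the summands with index (j, l). No other generator has
  \<open>idx_prime j l\<close> in its denominator: the primes are distinct, and l >= 2 keeps this
  one apart from every \<open>idx_prime j' 0\<close>.\<close>

lemma block_decomposition:
  assumes F: "set_mset F \<subseteq> Idx" and l: "2 \<le> l"
  obtains A B where "F = A + B" "\<And>i. i \<in># A \<Longrightarrow> \<exists>b. i = (j, l, b)"
    "\<And>b. (j, l, b) \<notin># B" "set_mset B \<subseteq> Idx"
    "integral_at (idx_prime j l) (\<Sum>i\<in>#B. gen i)" "0 \<le> (\<Sum>i\<in>#B. gen i)"
    "(\<Sum>i\<in>#A. gen i) = target j * of_nat (\<Sum>i\<in>#A. part i) / of_nat (idx_prime j l)"
proof
  let ?P = "\<lambda>i. fst i = j \<and> fst (snd i) = l"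
  let ?A = "filter_mset ?P F" and ?B = "filter_mset (\<lambda>i. \<not> ?P i) F"
  show "F = ?A + ?B" by (rule multiset_partition)
  show A: "\<exists>b. i = (j, l, b)" if "i \<in># ?A" for i using that by (cases i) auto
  show "(j, l, b) \<notin># ?B" for b by simp
  show B: "set_mset ?B \<subseteq> Idx" using F by auto
  show "integral_at (idx_prime j l) (\<Sum>i\<in>#?B. gen i)"
  proof (rule integral_at_sum_mset[OF prime_idx_prime])
    fix i assume i: "i \<in># ?B"
    then show "integral_at (idx_prime j l) (gen i)"
      using l by (cases i) (auto intro!: gen_integral_at prime_idx_prime simp: idx_prime_eq_iff)
  qed
  have "0 \<le> gen i" if "i \<in># ?B" for i
    using gen_ge_1[of i] B that by force
  then show "0 \<le> (\<Sum>i\<in>#?B. gen i)"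
    using sum_mset_ge_size[of ?B 0 gen] by simp
  have "(\<Sum>i\<in>#A. gen i) = target j * of_nat (\<Sum>i\<in>#A. part i) / of_nat (idx_prime j l)"
    if "\<forall>i\<in>#A. \<exists>b. i = (j, l, b)" for A
    using that by (induction A) (auto simp: gen_def add_divide_distrib ring_distribs)
  then show "(\<Sum>i\<in>#?A. gen i) = target j * of_nat (\<Sum>i\<in>#?A. part i) / of_nat (idx_prime j l)"
    using A by blast
qed

section \<open>Minimality of the generators\<close>

lemma sum_gen_le_0_imp_empty:
  assumes "set_mset B \<subseteq> Idx" "(\<Sum>i\<in>#B. gen i) \<le> 0"
  shows "B = {#}"
proof -
  have "of_nat (size B) * 1 \<le> (\<Sum>i\<in>#B. gen i)"
    by (rule sum_mset_ge_size) (use gen_ge_1 assms(1) in blast)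
  then have "rat_of_nat (size B) \<le> 0" using assms(2) by linarith
  then show ?thesis by simp
qed

lemma sum_part_pos:
  assumes "A \<noteq> {#}" "\<And>i. i \<in># A \<Longrightarrow> \<exists>b. i = (j, l, b)" "2 \<le> l"
  shows "0 < (\<Sum>i\<in>#A. part i)"
proof -
  obtain i A' where A: "A = add_mset i A'" using assms(1) by (meson multiset_cases)
  then have "0 < part i" using assms(2)[of i] part_bounds(3)[OF assms(3)] by auto
  then show ?thesis using A by simp
qed

text \<open>The summands outside the block of \<open>i\<close> add up to \<open>target j\<close>
  times (c - C)/p and are integral at p. Hence p divides c - C, which is at most c < p; so C = c,
  and nothing lies outside the block.\<close>

lemma sum_gen_eq_gen_size:
  assumes F: "set_mset F \<subseteq> Idx" and i: "i \<in> Idx" and sum: "(\<Sum>i\<in>#F. gen i) = gen i"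
  shows "size F = 1"
proof -
  obtain j l b where jl: "i = (j, l, b)" "2 \<le> l" using i by (auto simp: Idx_def)
  let ?p = "idx_prime j l" and ?c = "part i"
  obtain A B where AB: "F = A + B" "\<And>i. i \<in># A \<Longrightarrow> \<exists>b. i = (j, l, b)" "set_mset B \<subseteq> Idx"
    "integral_at ?p (\<Sum>i\<in>#B. gen i)" "0 \<le> (\<Sum>i\<in>#B. gen i)"
    "(\<Sum>i\<in>#A. gen i) = target j * of_nat (\<Sum>i\<in>#A. part i) / of_nat ?p"
    using block_decomposition[OF F jl(2), of j] by metis
  define C where "C = (\<Sum>i\<in>#A. part i)"
  have gi: "gen i = target j * of_nat ?c / of_nat ?p" by (simp add: gen_def jl)
  have p: "0 < (of_nat ?p :: rat)" using idx_prime_gt_2[of j l] by simp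
  have eq: "target j * of_nat C / of_nat ?p + (\<Sum>i\<in>#B. gen i) = target j * of_nat ?c / of_nat ?p"
    using sum gi AB unfolding C_def by simp
  then have "target j * of_nat C / of_nat ?p \<le> target j * of_nat ?c / of_nat ?p" using AB(5) by linarith
  \<comment> \<open>Settled before \<open>?c - C\<close> is formed, so that subtraction on
    \<open>nat\<close> does not truncate.\<close>
  then have le: "C \<le> ?c" using p target_pos[of j] by (simp add: divide_le_cancel)
  have "(\<Sum>i\<in>#B. gen i) = target j * of_nat (?c - C) / of_nat ?p"
    using eq le by (simp add: of_nat_diff right_diff_distrib diff_divide_distrib)
  then have "?p dvd ?c - C" using multiple_target_dvd AB(4) by metis
  moreover have c: "0 < ?c" "?c < ?p" using part_bounds[OF jl(2)] jl(1) by auto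
  ultimately have C: "C = ?c \<or> C = 0 \<and> ?p dvd ?c"
    using le nat_dvd_not_less[of "?c - C" ?p] by linarith
  with c have C: "C = ?c" using nat_dvd_not_less by blast
  with eq have B: "B = {#}" using sum_gen_le_0_imp_empty[OF AB(3)] by simp
  let ?q = "?p div l"
  \<comment> \<open>Every part is at least \<open>?q\<close>, while the single part C is below
    \<open>2 * ?q\<close>, so two summands do not fit.\<close>
  have "of_nat (size A) * ?q \<le> C"
    unfolding C_def by (rule sum_mset_ge_size) (use AB(2) part_bounds(1)[OF jl(2)] in fastforce)
  also have "C < 2 * ?q"
    using C part_bounds(2)[OF jl(2), of j b] idx_prime_bounds(4)[OF jl(2), of j]
    unfolding jl(1) by linarith
  finally have "size A < 2" by simp
  moreover have "A \<noteq> {#}" using C c C_def by auto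
  ultimately show ?thesis using AB(1) B by (cases A) auto
qed

section \<open>Factorizations of the targets\<close>

lemma sum_part_eq_idx_prime_size:
  assumes "\<And>i. i \<in># A \<Longrightarrow> \<exists>b. i = (j, l, b)" and l: "2 \<le> l"
    and C: "(\<Sum>i\<in>#A. part i) = idx_prime j l"
  shows "size A = l"
proof -
  let ?p = "idx_prime j l" let ?q = "?p div l" and ?r = "?p mod l"
  note b = idx_prime_bounds[OF l, of j]
  have "of_nat (size A) * ?q \<le> (\<Sum>i\<in>#A. part i)"
    by (rule sum_mset_ge_size) (use assms(1) part_bounds(1)[OF l] in fastforce)
  also note C
  \<comment> \<open>The remainder is below the quotient, so l + 1 parts already overshoot the
    prime.\<close>
  also have "?p < (l + 1) * ?q" using b(1,4) by (simp only: distrib_right)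
  finally have "size A \<le> l" by (simp del: mult_Suc)
  moreover have "l \<le> size A"
  proof (rule ccontr)
    assume "\<not> l \<le> size A"
    then have less: "size A \<le> l - 1" by simp
    have "(\<Sum>i\<in>#A. part i) \<le> of_nat (size A) * (?q + ?r)"
      by (rule sum_mset_le_size) (use assms(1) part_bounds(2)[OF l] in fastforce)
    also have "\<dots> \<le> (l - 1) * (?q + ?r)" using less by (simp only: of_nat_id mult_le_mono1)
    also have "\<dots> = (l - 1) * ?q + (l - 1) * ?r" by (rule distrib_left)
    \<comment> \<open>With fewer than l parts, even if all carry the remainder, the remainders
      together stay below one quotient and cannot replace the missing part. The bound
      \<open>l * l \<le> ?q\<close> comes from the cube in \<open>idx_prime\<close>.\<close>
    also have "(l - 1) * ?r < l * l" using b(3) l by (intro mult_strict_mono) auto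
    also have "l * l \<le> ?q" by (rule b)
    also have "(l - 1) * ?q + ?q = l * ?q" using l by (cases l) auto
    finally show False using b(1) C by simp
  qed
  ultimately show ?thesis by simp
qed

text \<open>The length turns out to be the second index of any summand whose first index is j, and
  \<open>Idx\<close> admits only elements of \<open>set_decode j\<close> there.\<close>

lemma sum_gen_eq_target_size:
  assumes F: "set_mset F \<subseteq> Idx" and sum: "(\<Sum>i\<in>#F. gen i) = target j"
  shows "size F \<in> set_decode j"
proof -
  \<comment> \<open>Otherwise no summand has \<open>idx_prime j 0\<close> in its denominator, while
    the target does.\<close>
  have "\<exists>l b. (j, l, b) \<in># F"
  proof (rule ccontr)
    assume *: "\<nexists>l b. (j, l, b) \<in># F"
    have "integral_at (idx_prime j 0) (\<Sum>i\<in>#F. gen i)"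
    proof (rule integral_at_sum_mset[OF prime_idx_prime])
      fix i assume i: "i \<in># F"
      with * F show "integral_at (idx_prime j 0) (gen i)"
        by (cases i) (auto intro!: gen_integral_at prime_idx_prime simp: idx_prime_eq_iff)
    qed
    then show False using sum target_not_integral by simp
  qed
  then obtain l b where jl: "(j, l, b) \<in># F" by blast
  then have l: "2 \<le> l" "l \<in> set_decode j" using F by (auto simp: Idx_def)
  let ?p = "idx_prime j l"
  obtain A B where AB: "F = A + B" "\<And>i. i \<in># A \<Longrightarrow> \<exists>b. i = (j, l, b)" "set_mset B \<subseteq> Idx"
    "\<And>b. (j, l, b) \<notin># B" "integral_at ?p (\<Sum>i\<in>#B. gen i)" "0 \<le> (\<Sum>i\<in>#B. gen i)"
    "(\<Sum>i\<in>#A. gen i) = target j * of_nat (\<Sum>i\<in>#A. part i) / of_nat ?p"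
    using block_decomposition[OF F l(1), of j] by metis
  define C where "C = (\<Sum>i\<in>#A. part i)"
  have eq: "target j * of_nat C / of_nat ?p + (\<Sum>i\<in>#B. gen i) = target j"
    using sum AB unfolding C_def by simp
  \<comment> \<open>As l is nonzero, \<open>?p\<close> differs from the denominator of
    \<open>target j\<close>, so the block \<open>A\<close> has an integral sum at \<open>?p\<close>
    as well.\<close>
  have "integral_at ?p (target j - (\<Sum>i\<in>#B. gen i))"
    using AB(5) l(1) by (intro integral_at_diff target_integral_at prime_idx_prime)
      (auto simp: idx_prime_eq_iff)
  also have "target j - (\<Sum>i\<in>#B. gen i) = target j * of_nat C / of_nat ?p"
    using eq by (simp only: diff_eq_eq)
  finally have "?p dvd C" by (rule multiple_target_dvd)
  \<comment> \<open>The summand found above lies in \<open>A\<close>, so C is a positive multiple of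
    \<open>?p\<close>. The block alone then reaches \<open>target j\<close> and leaves no room for
    \<open>B\<close>.\<close>
  moreover have "A \<noteq> {#}" using jl AB by auto
  then have "0 < C" unfolding C_def using sum_part_pos[OF _ AB(2) l(1)] by blast
  ultimately have ge: "?p \<le> C" by (rule dvd_imp_le)
  have p: "0 < (of_nat ?p :: rat)" using idx_prime_gt_2[of j l] by simp
  have "target j * of_nat ?p / of_nat ?p \<le> target j * of_nat C / of_nat ?p"
    using ge p target_pos[of j] by (intro divide_right_mono mult_left_mono) auto
  then have "(\<Sum>i\<in>#B. gen i) \<le> 0" using eq p by simp
  then have B: "B = {#}" using sum_gen_le_0_imp_empty[OF AB(3)] by simp
  then have "target j * of_nat C = target j * of_nat ?p" using eq p by (simp add: field_simps)
  then have "C = ?p" using target_pos[of j] by simp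
  then have "size A = l" using sum_part_eq_idx_prime_size AB(2) l(1) unfolding C_def by blast
  then show ?thesis using AB(1) B l by simp
qed

lemma target_factorization:
  assumes "l \<in> set_decode j" "2 \<le> l"
  obtains F where "set_mset F \<subseteq> Idx" "(\<Sum>i\<in>#F. gen i) = target j" "size F = l"
proof
  \<comment> \<open>One part with the remainder and l - 1 without it: the numerators give (q + r) +
    (l - 1)q, which is the prime.\<close>
  let ?F = "add_mset (j, l, True) (replicate_mset (l - 1) (j, l, False))"
  let ?p = "idx_prime j l" let ?q = "?p div l" and ?r = "?p mod l"
  show "set_mset ?F \<subseteq> Idx" using assms by (auto simp: Idx_def)
  show "size ?F = l" using assms(2) by simp
  have p: "0 < (of_nat ?p :: rat)" using idx_prime_gt_2[of j l] by simp
  have "(\<Sum>i\<in>#?F. gen i) = target j * of_nat (?q + ?r + (l - 1) * ?q) / of_nat ?p"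
    by (simp add: gen_def part_def add_divide_distrib ring_distribs)
  also have "?q + ?r + (l - 1) * ?q = ?p"
    using idx_prime_bounds(1)[OF assms(2), of j] assms(2) by (cases l) auto
  finally show "(\<Sum>i\<in>#?F. gen i) = target j" using p by simp
qed

section \<open>The system of sets of lengths\<close>

interpretation gens: minimal_generators "gen ` Idx"
proof
  show "1 \<le> g" if "g \<in> gen ` Idx" for g using that gen_ge_1 by auto
  show "size F = 1" if F: "set_mset F \<subseteq> gen ` Idx" and s: "sum_mset F \<in> gen ` Idx" for F
  proof -
    obtain F' where "set_mset F' \<subseteq> Idx" "F = image_mset gen F'"
      using mset_subset_imageE[OF F] .
    then show ?thesis using s sum_gen_eq_gen_size by auto
  qed
qed

text \<open>\<open>Idx\<close> supplies generators only for lengths at least 2; the assumption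
  ensures that every element of the set is realized.\<close>

lemma set_of_lengths_target:
  assumes "set_decode j \<subseteq> {2..}"
  shows "set_of_lengths (generated_monoid (gen ` Idx)) (target j) = set_decode j"
proof (intro equalityI subsetI)
  fix n assume "n \<in> set_of_lengths (generated_monoid (gen ` Idx)) (target j)"
  then obtain F where F: "set_mset F \<subseteq> gen ` Idx" "sum_mset F = target j" "n = size F"
    by (auto simp: gens.set_of_lengths_generated)
  obtain F' where "set_mset F' \<subseteq> Idx" "F = image_mset gen F'"
    using mset_subset_imageE[OF F(1)] .
  then show "n \<in> set_decode j" using F sum_gen_eq_target_size by auto
next
  fix l assume l: "l \<in> set_decode j"
  with assms obtain F where F: "set_mset F \<subseteq> Idx" "(\<Sum>i\<in>#F. gen i) = target j" "size F = l"
    using target_factorization by (metis atLeast_iff subsetD)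
  then show "l \<in> set_of_lengths (generated_monoid (gen ` Idx)) (target j)"
    by (force simp: gens.set_of_lengths_generated intro!: exI[of _ "image_mset gen F"])
qed

lemma target_mem:
  assumes "set_decode j \<subseteq> {2..}" "set_decode j \<noteq> {}"
  shows "target j \<in> generated_monoid (gen ` Idx)"
proof -
  obtain l where "l \<in> set_decode j" "2 \<le> l" using assms by fastforce
  then obtain F where "set_mset F \<subseteq> Idx" "(\<Sum>i\<in>#F. gen i) = target j"
    using target_factorization by metis
  then show ?thesis by (force simp: generated_monoid_def intro!: exI[of _ "image_mset gen F"])
qed

theorem theorem3p6:
  shows "\<exists>M :: rat set. puiseux_monoid M \<and> atomic M \<and> BF_monoid M \<and>
    system_of_sets_of_lengths M =
      {{0}, {1}} \<union> {S. S \<subseteq> {2..} \<and> S \<noteq> {} \<and> finite S}"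
proof (intro exI conjI)
  let ?M = "generated_monoid (gen ` Idx)"
  show "puiseux_monoid ?M" by (rule gens.puiseux_monoid_generated)
  show "atomic ?M" by (rule gens.atomic_generated)
  show "BF_monoid ?M" by (rule gens.BF_monoid_generated)
  show "system_of_sets_of_lengths ?M =
      {{0}, {1}} \<union> {S. S \<subseteq> {2..} \<and> S \<noteq> {} \<and> finite S}" (is "?\<L> = ?R")
  proof
    show "?\<L> \<subseteq> ?R"
      unfolding system_of_sets_of_lengths_def by (rule image_subsetI) (rule gens.set_of_lengths_cases)
    have "{0} \<in> ?\<L>"
      unfolding system_of_sets_of_lengths_def
      by (rule image_eqI[of _ _ 0]) (simp_all add: gens.set_of_lengths_zero generated_monoid_empty)
    moreover have "{1} \<in> ?\<L>"
      unfolding system_of_sets_of_lengths_def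
    proof (rule image_eqI)
      \<comment> \<open>Any generator has set of lengths {1}; the code of {2} is a convenient
        witness that one exists.\<close>
      have "(set_encode {2}, 2, True) \<in> Idx" by (simp add: Idx_def del: set_encode_insert)
      then have g: "gen (set_encode {2}, 2, True) \<in> gen ` Idx" by (rule imageI)
      show "{1} = set_of_lengths ?M (gen (set_encode {2}, 2, True))"
        using gens.set_of_lengths_generator[OF g] by simp
      show "gen (set_encode {2}, 2, True) \<in> ?M" using g generated_monoid_superset by blast
    qed
    moreover have "S \<in> ?\<L>" if S: "S \<subseteq> {2..}" "S \<noteq> {}" "finite S" for S
      unfolding system_of_sets_of_lengths_def
    proof (rule image_eqI)
      \<comment> \<open>Finiteness of \<open>S\<close> enters here: \<open>set_decode\<close>
        recovers a set from its code when the set is finite.\<close>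
      have d: "set_decode (set_encode S) = S" using S by (simp add: set_encode_inverse)
      show "S = set_of_lengths ?M (target (set_encode S))"
        using set_of_lengths_target[of "set_encode S"] d S by simp
      show "target (set_encode S) \<in> ?M" using target_mem[of "set_encode S"] d S by simp
    qed
    ultimately show "?R \<subseteq> ?\<L>" by blast
  qed
qed

end
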